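(* Let $0\le m\le M-1$ and let $(\vec U^{m+1},P^{m+1},\vec X^{m+1},\kappa^{m+1})\in\mathbb U^m\times\widehat{\mathbb P}^m\times\underline V(\Gamma^m)\times W(\Gamma^m)$ be a solution to the full discrete system (a)--(d) with $\vec f^{m+1}=\vec 0$. If $\vec X^{m+1}=\vec X^m$, then $\vec U^{m+1}=\vec 0$.
   Context: Bulk. $d\in\{2,3\}$, $\Omega\subset\mathbb R^d$ is a bounded polyhedral domain, $0=t_0<\dots<t_M=T$, $\tau_m=t_{m+1}-t_m>0$. $\mathcal T^m$ is a regular partitioning of $\Omega$ into disjoint open simplices; $S^m_0$ is the space of piecewise constants on $\mathcal T^m$. $\mathbb U^m\subset H^1_0(\Omega,\mathbb R^d)$ is a finite-dimensional finite element space of continuous functions on $\mathcal T^m$, $\mathbb P^m\subset L^2(\Omega)$ is a finite-dimensional pressure space, and $\widehat{\mathbb P}^m=\{\varphi\in\mathbb P^m:\int_\Omega\varphi=0\}$. $(\cdot,\cdot)$ is the $L^2$ inner product on $\Omega$, $\underline{\underline D}(\vec u)=\frac12(\nabla\vec u+(\nabla\vec u)^T)$. Interface. $\Gamma^m=\bigcup_{j=1}^{J}\overline{\sigma^m_j}\subset\overline\Omega$ is a closed polyhedral surface without self-intersections: a union of mutually disjoint open non-degenerate $(d-1)$-simplices $\sigma^m_j$ with no hanging vertices. $\Omega^m_-$ is its interior, $\Omega^m_+$ its exterior (in $\Omega$), and $\vec\nu^m$ is the piecewise constant unit normal on $\Gamma^m$ pointing into $\Omega^m_+$. $W(\Gamma^m)$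 is the space of scalar continuous functions on $\Gamma^m$ that are affine on each $\sigma^m_j$, and $\underline V(\Gamma^m)=[W(\Gamma^m)]^d$. $\vec X^m\in\underline V(\Gamma^m)$ is the identity function on $\Gamma^m$. $\langle v,w\rangle_{\Gamma^m}=\int_{\Gamma^m}v\cdot w\,d\mathcal H^{d-1}$, $\nabla_s$ is the surface gradient on $\Gamma^m$, and the mass lumped product for piecewise continuous $v,w$ is $\langle v,w\rangle^h_{\Gamma^m}=\frac1d\sum_j\mathcal H^{d-1}(\sigma^m_j)\sum_{k=1}^d (v\cdot w)((\vec q^m_{j_k})^-)$, where $\vec q^m_{j_1},\dots,\vec q^m_{j_d}$ are the vertices of $\sigma^m_j$ and $(\cdot)^-$ denotes the limit from within $\sigma^m_j$. Data. $\gamma>0$, $\mu_\pm>0$; $\mu^m\in S^m_0$ equals $\mu_-$ on elements contained in $\Omega^m_-$, $\mu_+$ on elements contained in $\Omega^m_+$, and $\frac12(\mu_-+\mu_+)$ on elements intersecting $\Gamma^m$. $\vec f^{m+1}$ is the discrete forcing. Full discrete system: find $(\vec U^{m+1},P^{m+1},\vec X^{m+1},\kappa^{m+1})\in\mathbb U^m\times\widehat{\mathbb P}^m\times\underline V(\Gamma^m)\times W(\Gamma^m)$ with (a) $2(\mu^m\underline{\underline D}(\vec U^{m+1}),\underline{\underline D}(\vec\xi))-(P^{m+1},\nabla\cdot\vec\xi)-\gamma\langle\kappa^{m+1}\vec\nu^m,\vec\xi\rangle_{\Gamma^m}=(\vec f^{m+1},\vec\xi)$ for all $\vec\xi\in\mathbb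 U^m$; (b) $(\nabla\cdot\vec U^{m+1},\varphi)=0$ for all $\varphi\in\widehat{\mathbb P}^m$; (c) $\big\langle\frac{\vec X^{m+1}-\vec X^m}{\tau_m},\chi\vec\nu^m\big\rangle^h_{\Gamma^m}-\langle\vec U^{m+1},\chi\vec\nu^m\rangle_{\Gamma^m}=0$ for all $\chi\in W(\Gamma^m)$; (d) $\langle\kappa^{m+1}\vec\nu^m,\vec\eta\rangle^h_{\Gamma^m}+\langle\nabla_s\vec X^{m+1},\nabla_s\vec\eta\rangle_{\Gamma^m}=0$ for all $\vec\eta\in\underline V(\Gamma^m)$. *)

theory Defs
  imports "HOL-Analysis.Analysis"
begin

text \<open>
  Scalar and vector fields are total functions on \<open>real^'d\<close>; only their values on the set they
  live on (\<open>\<Omega>\<close>, \<open>closure \<Omega>\<close> or the surface) matter.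
\<close>

definition finite_dim_space :: "('a \<Rightarrow> 'b::real_vector) set \<Rightarrow> bool" where
  "finite_dim_space V \<longleftrightarrow>
     (\<exists>(n::nat) b. V = {u. \<exists>c::nat \<Rightarrow> real. u = (\<lambda>x. \<Sum>i<n. c i *\<^sub>R b i x)})"


subsection \<open>Smooth functions and test functions\<close>

definition partial_deriv :: "'d \<Rightarrow> (real^'d \<Rightarrow> real) \<Rightarrow> real^'d \<Rightarrow> real" where
  "partial_deriv j f x = frechet_derivative f (at x) (axis j 1)"

definition jacobian :: "(real^'d \<Rightarrow> real^'d) \<Rightarrow> real^'d \<Rightarrow> real^'d^'d" where
  "jacobian v x = (\<chi> i j. partial_deriv j (\<lambda>y. v y $ i) x)"

primrec C_k :: "nat \<Rightarrow> (real^'d \<Rightarrow> real) \<Rightarrow> bool" where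
  "C_k 0 f \<longleftrightarrow> continuous_on UNIV f"
| "C_k (Suc k) f \<longleftrightarrow> f differentiable_on UNIV \<and> (\<forall>j. C_k k (partial_deriv j f))"

definition smooth :: "(real^'d \<Rightarrow> real) \<Rightarrow> bool" where
  "smooth f \<longleftrightarrow> (\<forall>k. C_k k f)"

definition test_function :: "(real^'d) set \<Rightarrow> (real^'d \<Rightarrow> real) \<Rightarrow> bool" where
  "test_function \<Omega> \<phi> \<longleftrightarrow> smooth \<phi> \<and> (\<exists>K. compact K \<and> K \<subseteq> \<Omega> \<and> (\<forall>x. x \<notin> K \<longrightarrow> \<phi> x = 0))"


subsection \<open>Lebesgue and Sobolev spaces\<close>

definition L2 :: "(real^'d) set \<Rightarrow> (real^'d \<Rightarrow> 'b::euclidean_space) set" where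
  "L2 \<Omega> = {f. f \<in> borel_measurable (lebesgue_on \<Omega>) \<and>
              integrable (lebesgue_on \<Omega>) (\<lambda>x. (norm (f x))\<^sup>2)}"

text \<open>On \<open>real^'d^'d\<close> the library inner product is the Frobenius product.\<close>

definition L2_inner ::
    "(real^'d) set \<Rightarrow> (real^'d \<Rightarrow> 'b::euclidean_space) \<Rightarrow> (real^'d \<Rightarrow> 'b) \<Rightarrow> real" where
  "L2_inner \<Omega> f g = (LINT x|lebesgue_on \<Omega>. f x \<bullet> g x)"

definition has_weak_gradient ::
    "(real^'d) set \<Rightarrow> (real^'d \<Rightarrow> real^'d) \<Rightarrow> (real^'d \<Rightarrow> real^'d^'d) \<Rightarrow> bool" where
  "has_weak_gradient \<Omega> u G \<longleftrightarrow> (\<forall>\<phi>. test_function \<Omega> \<phi> \<longrightarrow> (\<forall>i j.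
     (LINT x|lebesgue_on \<Omega>. u x $ i * partial_deriv j \<phi> x) =
     - (LINT x|lebesgue_on \<Omega>. G x $ i $ j * \<phi> x)))"

definition H1 :: "(real^'d) set \<Rightarrow> (real^'d \<Rightarrow> real^'d) set" where
  "H1 \<Omega> = {u \<in> L2 \<Omega>. \<exists>G \<in> L2 \<Omega>. has_weak_gradient \<Omega> u G}"

text \<open>The weak gradient is unique up to null sets; the choice of representative is irrelevant.\<close>

definition weak_gradient :: "(real^'d) set \<Rightarrow> (real^'d \<Rightarrow> real^'d) \<Rightarrow> real^'d \<Rightarrow> real^'d^'d" where
  "weak_gradient \<Omega> u = (SOME G. G \<in> L2 \<Omega> \<and> has_weak_gradient \<Omega> u G)"

text \<open>Closure of the compactly supported smooth fields in the \<open>H1\<close> norm.\<close>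

definition H1_0 :: "(real^'d) set \<Rightarrow> (real^'d \<Rightarrow> real^'d) set" where
  "H1_0 \<Omega> = {u \<in> H1 \<Omega>. \<forall>\<epsilon>>0. \<exists>\<phi>. (\<forall>i. test_function \<Omega> (\<lambda>x. \<phi> x $ i)) \<and>
     (LINT x|lebesgue_on \<Omega>. (norm (u x - \<phi> x))\<^sup>2) +
     (LINT x|lebesgue_on \<Omega>. (norm (weak_gradient \<Omega> u x - jacobian \<phi> x))\<^sup>2) < \<epsilon>}"

definition strain :: "(real^'d) set \<Rightarrow> (real^'d \<Rightarrow> real^'d) \<Rightarrow> real^'d \<Rightarrow> real^'d^'d" where
  "strain \<Omega> u x = (1/2) *\<^sub>R (weak_gradient \<Omega> u x + transpose (weak_gradient \<Omega> u x))"

definition divergence :: "(real^'d) set \<Rightarrow> (real^'d \<Rightarrow> real^'d) \<Rightarrow> real^'d \<Rightarrow> real" where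
  "divergence \<Omega> u x = trace (weak_gradient \<Omega> u x)"


subsection \<open>Domain, bulk mesh and bulk finite element spaces\<close>

definition polyhedral_domain :: "(real^'d) set \<Rightarrow> bool" where
  "polyhedral_domain \<Omega> \<longleftrightarrow> \<Omega> \<noteq> {} \<and> open \<Omega> \<and> connected \<Omega> \<and> bounded \<Omega> \<and>
     (\<exists>\<F>. finite \<F> \<and> (\<forall>F\<in>\<F>. polytope F \<and> aff_dim F = int CARD('d) - 1) \<and> frontier \<Omega> = \<Union>\<F>)"

text \<open>
  Meshes are sets of closed simplices; the open elements are their (relative) interiors. The
  library's \<open>triangulation\<close> demands that two elements meet in a common face, so the open elements
  are mutually disjoint and there are no hanging vertices.
\<close>

definition simplicial_partition :: "(real^'d) set \<Rightarrow> (real^'d) set set \<Rightarrow> bool" where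
  "simplicial_partition \<Omega> \<T> \<longleftrightarrow> triangulation \<T> \<and> (\<forall>K\<in>\<T>. int CARD('d) simplex K) \<and>
     (\<forall>K\<in>\<T>. interior K \<subseteq> \<Omega>) \<and> \<Union>\<T> = closure \<Omega>"

definition S_0 :: "(real^'d) set set \<Rightarrow> (real^'d \<Rightarrow> real) set" where
  "S_0 \<T> = {f. \<forall>K\<in>\<T>. f constant_on interior K}"

text \<open>
  The shape functions on an element are only required to be smooth up to the boundary of the
  element, which covers in particular all piecewise polynomial spaces.
\<close>

definition velocity_space :: "(real^'d) set \<Rightarrow> (real^'d) set set \<Rightarrow> (real^'d \<Rightarrow> real^'d) set \<Rightarrow> bool"
  where
  "velocity_space \<Omega> \<T> \<U> \<longleftrightarrow> finite_dim_space \<U> \<and> \<U> \<subseteq> H1_0 \<Omega> \<and>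
     (\<forall>u\<in>\<U>. continuous_on (closure \<Omega>) u \<and>
       (\<forall>K\<in>\<T>. \<forall>i. \<exists>p. smooth p \<and> (\<forall>x\<in>K. u x $ i = p x)))"

definition pressure_space :: "(real^'d) set \<Rightarrow> (real^'d \<Rightarrow> real) set \<Rightarrow> bool" where
  "pressure_space \<Omega> \<P> \<longleftrightarrow> finite_dim_space \<P> \<and> \<P> \<subseteq> L2 \<Omega>"

definition mean_zero :: "(real^'d) set \<Rightarrow> (real^'d \<Rightarrow> real) set \<Rightarrow> (real^'d \<Rightarrow> real) set" where
  "mean_zero \<Omega> \<P> = {\<phi> \<in> \<P>. (LINT x|lebesgue_on \<Omega>. \<phi> x) = 0}"


subsection \<open>Hausdorff measure\<close>

text \<open>
  The \<open>s\<close>-dimensional Hausdorff measure, for \<open>s \<ge> 1\<close>, normalised to agree with Lebesgue measure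
  on \<open>s\<close>-dimensional subspaces. The library's \<open>diameter\<close> is meaningful for bounded sets only,
  whence the boundedness condition on the covers. The outer measure is a metric outer measure and
  hence countably additive on Borel sets, so \<open>measure_of\<close> does not fall back to the zero measure.
\<close>

definition hausdorff_pre :: "nat \<Rightarrow> real \<Rightarrow> 'a::metric_space set \<Rightarrow> ennreal" where
  "hausdorff_pre s \<delta> A =
     (INF C \<in> {C::nat \<Rightarrow> 'a set. A \<subseteq> (\<Union>i. C i) \<and> (\<forall>i. bounded (C i) \<and> diameter (C i) \<le> \<delta>)}.
        \<Sum>i. ennreal (unit_ball_vol (real s) * (diameter (C i) / 2) ^ s))"

definition hausdorff_measure :: "nat \<Rightarrow> 'a::metric_space measure" where
  "hausdorff_measure s = measure_of UNIV (sets borel) (\<lambda>A. SUP \<delta>\<in>{0<..}. hausdorff_pre s \<delta> A)"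

definition surface_measure :: "(real^'d) measure" where
  "surface_measure = hausdorff_measure (CARD('d) - 1)"


subsection \<open>Polyhedral surface\<close>

text \<open>
  The union of the mesh is a compact \<open>(d-1)\<close>-manifold without boundary embedded in space: every
  point has a relatively open neighbourhood homeomorphic to a hyperplane.
\<close>

definition polyhedral_surface :: "(real^'d) set set \<Rightarrow> bool" where
  "polyhedral_surface \<S> \<longleftrightarrow> \<S> \<noteq> {} \<and> triangulation \<S> \<and>
     (\<forall>S\<in>\<S>. (int CARD('d) - 1) simplex S) \<and>
     (\<forall>x\<in>\<Union>\<S>. \<exists>N a. x \<in> N \<and> openin (top_of_set (\<Union>\<S>)) N \<and>
        a \<noteq> 0 \<and> N homeomorphic {y::real^'d. a \<bullet> y = 0})"

text \<open>
  The normal points into the exterior \<open>outside (\<Union>\<S>)\<close>. At points of the surface that lie in \<open>\<Omega>\<close>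
  this is the same as pointing into \<open>\<Omega> \<inter> outside (\<Union>\<S>)\<close>, but it also makes sense for facets that
  lie on the boundary of \<open>\<Omega>\<close>. The value 0 off the open simplices, a set of surface measure zero,
  only serves to make the field Borel measurable.
\<close>

definition unit_normal :: "(real^'d) set set \<Rightarrow> (real^'d \<Rightarrow> real^'d) \<Rightarrow> bool" where
  "unit_normal \<S> \<nu> \<longleftrightarrow>
     (\<forall>S\<in>\<S>. \<exists>n. norm n = 1 \<and> (\<forall>y\<in>S. \<forall>z\<in>S. n \<bullet> (y - z) = 0) \<and>
        (\<forall>x\<in>rel_interior S. \<nu> x = n \<and>
           (\<forall>\<^sub>F s in at_right 0. x + s *\<^sub>R n \<in> outside (\<Union>\<S>)))) \<and>
     (\<forall>x. x \<notin> (\<Union>S\<in>\<S>. rel_interior S) \<longrightarrow> \<nu> x = 0)"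

definition W_space :: "(real^'d) set set \<Rightarrow> (real^'d \<Rightarrow> real) set" where
  "W_space \<S> = {w. continuous_on (\<Union>\<S>) w \<and> (\<forall>S\<in>\<S>. \<exists>a b. \<forall>x\<in>S. w x = a \<bullet> x + b)}"

definition V_space :: "(real^'d) set set \<Rightarrow> (real^'d \<Rightarrow> real^'d) set" where
  "V_space \<S> = {v. \<forall>i. (\<lambda>x. v x $ i) \<in> W_space \<S>}"

definition surf_inner ::
    "(real^'d) set set \<Rightarrow> (real^'d \<Rightarrow> 'b::euclidean_space) \<Rightarrow> (real^'d \<Rightarrow> 'b) \<Rightarrow> real" where
  "surf_inner \<S> v w = (LINT x:(\<Union>\<S>)|surface_measure. v x \<bullet> w x)"

text \<open>The vertices of a simplex are its extreme points.\<close>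

definition lumped_inner ::
    "(real^'d) set set \<Rightarrow> (real^'d \<Rightarrow> 'b::euclidean_space) \<Rightarrow> (real^'d \<Rightarrow> 'b) \<Rightarrow> real" where
  "lumped_inner \<S> v w = (1 / real CARD('d)) *
     (\<Sum>S\<in>\<S>. measure surface_measure (rel_interior S) *
        (\<Sum>q\<in>{q. q extreme_point_of S}. Lim (at q within rel_interior S) (\<lambda>x. v x \<bullet> w x)))"

text \<open>
  At a point of an open simplex, the surface gradient is the vector of the tangent space that
  represents the derivative along the simplex.
\<close>

definition surf_grad :: "(real^'d) set set \<Rightarrow> (real^'d \<Rightarrow> real) \<Rightarrow> real^'d \<Rightarrow> real^'d" where
  "surf_grad \<S> f x = (if x \<in> (\<Union>S\<in>\<S>. rel_interior S)
     then (THE g. \<exists>S\<in>\<S>. x \<in> rel_interior S \<and> g \<in> (\<lambda>y. y - x) ` (affine hull S) \<and>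
             (f has_derivative (\<lambda>h. g \<bullet> h)) (at x within S))
     else 0)"

definition surf_jacobian :: "(real^'d) set set \<Rightarrow> (real^'d \<Rightarrow> real^'d) \<Rightarrow> real^'d \<Rightarrow> real^'d^'d" where
  "surf_jacobian \<S> v x = (\<chi> i. surf_grad \<S> (\<lambda>y. v y $ i) x)"


subsection \<open>The discrete problem\<close>

definition viscosity ::
    "(real^'d) set \<Rightarrow> (real^'d) set set \<Rightarrow> (real^'d) set set \<Rightarrow> real \<Rightarrow> real \<Rightarrow> (real^'d \<Rightarrow> real) \<Rightarrow> bool"
  where
  "viscosity \<Omega> \<T> \<S> \<mu>\<^sub>m \<mu>\<^sub>p \<mu> \<longleftrightarrow> \<mu> \<in> S_0 \<T> \<and>
     (\<forall>K\<in>\<T>. \<forall>x\<in>interior K.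
        (interior K \<subseteq> inside (\<Union>\<S>) \<longrightarrow> \<mu> x = \<mu>\<^sub>m) \<and>
        (interior K \<subseteq> \<Omega> \<inter> outside (\<Union>\<S>) \<longrightarrow> \<mu> x = \<mu>\<^sub>p) \<and>
        (interior K \<inter> \<Union>\<S> \<noteq> {} \<longrightarrow> \<mu> x = (\<mu>\<^sub>m + \<mu>\<^sub>p) / 2))"

definition discrete_solution ::
    "(real^'d) set \<Rightarrow> (real^'d) set set \<Rightarrow> (real^'d \<Rightarrow> real^'d) \<Rightarrow>
     (real^'d \<Rightarrow> real^'d) set \<Rightarrow> (real^'d \<Rightarrow> real) set \<Rightarrow>
     real \<Rightarrow> (real^'d \<Rightarrow> real) \<Rightarrow> real \<Rightarrow> (real^'d \<Rightarrow> real^'d) \<Rightarrow>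
     (real^'d \<Rightarrow> real^'d) \<Rightarrow> (real^'d \<Rightarrow> real) \<Rightarrow> (real^'d \<Rightarrow> real^'d) \<Rightarrow> (real^'d \<Rightarrow> real) \<Rightarrow> bool"
  where
  "discrete_solution \<Omega> \<S> \<nu> \<U> \<P> \<gamma> \<mu> \<tau> f U P X \<kappa> \<longleftrightarrow>
     U \<in> \<U> \<and> P \<in> mean_zero \<Omega> \<P> \<and> X \<in> V_space \<S> \<and> \<kappa> \<in> W_space \<S> \<and>
     (\<forall>\<xi>\<in>\<U>. 2 * L2_inner \<Omega> (\<lambda>x. \<mu> x *\<^sub>R strain \<Omega> U x) (strain \<Omega> \<xi>)
             - L2_inner \<Omega> P (divergence \<Omega> \<xi>)
             - \<gamma> * surf_inner \<S> (\<lambda>x. \<kappa> x *\<^sub>R \<nu> x) \<xi> = L2_inner \<Omega> f \<xi>) \<and>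
     (\<forall>\<phi>\<in>mean_zero \<Omega> \<P>. L2_inner \<Omega> (divergence \<Omega> U) \<phi> = 0) \<and>
     (\<forall>w\<in>W_space \<S>. lumped_inner \<S> (\<lambda>x. (1/\<tau>) *\<^sub>R (X x - x)) (\<lambda>x. w x *\<^sub>R \<nu> x)
             - surf_inner \<S> U (\<lambda>x. w x *\<^sub>R \<nu> x) = 0) \<and>
     (\<forall>\<eta>\<in>V_space \<S>. lumped_inner \<S> (\<lambda>x. \<kappa> x *\<^sub>R \<nu> x) \<eta>
             + surf_inner \<S> (surf_jacobian \<S> X) (surf_jacobian \<S> \<eta>) = 0)"

end

(* Testing (a) with U, (b) with P and (c) with kappa gives (mu D(U), D(U)) = 0, since the lumped
   term vanishes for X = id. As mu is positive on every open element, D(U) = 0 almost everywhere.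
   The i-th diagonal entry of D(U) is the i-th partial derivative of the i-th component of U, so the
   Poincare inequality in the i-th coordinate direction, applied to test functions that approximate
   U, gives U = 0 without Korn's inequality. *)

theory Submission
  imports Defs
begin

text \<open>The Bochner integral of a non-integrable function is 0. A vanishing energy, or the small
  sum of integrals in \<open>H1_0\<close>, is therefore informative only once the integrands are
  known to be integrable; this is what the \<open>L2\<close> and measurability lemmas are for. A
  second obstacle is that \<mu> is prescribed on the open elements only and that weak gradients are
  determined only up to null sets, so the energy argument works almost everywhere, and the
  continuity of U on the closure of the domain restores a pointwise conclusion. The strain gives no
  direct hold on off-diagonal derivatives, but each component needs just one derivative, since a
  function of compact support is controlled by its derivative along any single direction. The
  homogeneous boundary condition enters through the compact supports of the approximating fields,
  which also allow integration over the whole space without boundary terms.\<close>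

section \<open>Compactly supported functions on the whole space and a directional Poincare
  inequality\<close>

lemma integrable_lborel_compact_support:
  fixes f :: "'a::euclidean_space \<Rightarrow> real"
  assumes "continuous_on UNIV f" "compact K" "\<And>x. x \<notin> K \<Longrightarrow> f x = 0"
  shows "integrable lborel f"
proof -
  have "integrable lborel (\<lambda>x. indicator K x *\<^sub>R f x)"
    using assms(1,2) by (intro borel_integrable_compact) (auto intro: continuous_on_subset)
  moreover have "(\<lambda>x. indicator K x *\<^sub>R f x) = f"
    using assms(3) by (fastforce simp: indicator_def)
  ultimately show ?thesis by simp
qed

lemma integral_lborel_translate:
  fixes f :: "'a::euclidean_space \<Rightarrow> real"
  assumes "f \<in> borel_measurable borel"
  shows "(LINT x|lborel. f (x + c)) = (LINT x|lborel. f x)"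
proof -
  have "(LINT x|lborel. f x) = (LINT x|distr lborel borel ((+) c). f x)"
    by (simp add: lborel_distr_plus)
  also have "\<dots> = (LINT x|lborel. f (c + x))"
    using assms by (intro integral_distr) auto
  finally show ?thesis by (simp add: add.commute)
qed

lemma derivative_eq_0_off_support:
  fixes f :: "'a::euclidean_space \<Rightarrow> real"
  assumes "(f has_derivative F) (at x)" "compact K" "\<And>x. x \<notin> K \<Longrightarrow> f x = 0" "x \<notin> K"
  shows "F = (\<lambda>_. 0)"
proof -
  have "(f has_derivative (\<lambda>_. 0)) (at x)"
    using assms by (intro has_derivative_transform_within_open[OF has_derivative_const, of "- K" x 0 f])
      (auto intro: compact_imp_closed)
  then show ?thesis using assms(1) has_derivative_unique by blast
qed

text \<open>Translation invariance makes the integral of every difference quotient vanish.\<close>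

lemma integral_directional_derivative_eq_0:
  fixes f :: "'a::euclidean_space \<Rightarrow> real"
  assumes deriv: "\<And>x. (f has_derivative F x) (at x)"
    and cont: "continuous_on UNIV (\<lambda>x. F x e)"
    and K: "compact K" and supp: "\<And>x. x \<notin> K \<Longrightarrow> f x = 0"
  shows "(LINT x|lborel. F x e) = 0"
proof -
  \<comment> \<open>Forward difference quotients with step 1/(n+1); \<open>Suc\<close> keeps the
    step nonzero.\<close>
  define q where "q = (\<lambda>n x. real (Suc n) * (f (x + inverse (real (Suc n)) *\<^sub>R e) - f x))"
  have contf: "continuous_on UNIV f"
    using deriv has_derivative_continuous by (force simp: continuous_on_eq_continuous_at)
  then have meas: "f \<in> borel_measurable borel" by (rule borel_measurable_continuous_onI)
  have suppF: "F x e = 0" if "x \<notin> K" for x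
    using derivative_eq_0_off_support[OF deriv K supp that] by simp
  have "bounded ((\<lambda>x. F x e) ` K)"
    using K cont by (intro compact_imp_bounded compact_continuous_image) (auto intro: continuous_on_subset)
  then obtain B where B: "B > 0" "\<And>x. x \<in> K \<Longrightarrow> \<bar>F x e\<bar> \<le> B"
    unfolding bounded_pos by auto
  then have B': "\<bar>F x e\<bar> \<le> B" for x
    using suppF[of x] by (cases "x \<in> K") auto
  obtain R where R: "\<And>x. x \<in> K \<Longrightarrow> norm x \<le> R"
    using compact_imp_bounded[OF K] unfolding bounded_iff by auto
  \<comment> \<open>Every step has length at most \<open>norm e\<close>, so both x and the shifted
    point miss K when x is outside this ball. A constant times its indicator dominates all quotients
    at once.\<close>
  define C where "C = cball (0::'a) (R + norm e)"
  have q0: "(LINT x|lborel. q n x) = 0" for n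
  proof -
    let ?c = "inverse (real (Suc n)) *\<^sub>R e"
    have "integrable lborel f" by (rule integrable_lborel_compact_support[OF contf K supp])
    moreover have "integrable lborel (\<lambda>x. f (x + ?c))"
    proof (rule integrable_lborel_compact_support)
      show "continuous_on UNIV (\<lambda>x. f (x + ?c))"
        by (intro continuous_on_compose2[OF contf] continuous_intros) auto
      show "compact ((\<lambda>x. x - ?c) ` K)"
        by (intro compact_continuous_image K continuous_intros)
      show "f (x + ?c) = 0" if "x \<notin> (\<lambda>x. x - ?c) ` K" for x
        using that by (intro supp) (metis add_diff_cancel_right' imageI)
    qed
    ultimately show ?thesis
      unfolding q_def using integral_lborel_translate[OF meas, of ?c]
      by (simp add: Bochner_Integration.integral_diff)
  qed
  have qlim: "(\<lambda>n. q n x) \<longlonglongrightarrow> F x e" for x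
  proof -
    have "((\<lambda>s. f (x + s *\<^sub>R e)) has_derivative (\<lambda>s. F x (s *\<^sub>R e))) (at (0::real))"
      by (rule derivative_eq_intros has_derivative_compose[where g = f, OF _ deriv, THEN has_derivative_eq_rhs]
          | simp add: deriv)+
    moreover have "(\<lambda>s. F x (s *\<^sub>R e)) = (*) (F x e)"
      using deriv[of x] by (auto simp: linear_cmul[OF has_derivative_linear] mult.commute)
    ultimately have "((\<lambda>s. f (x + s *\<^sub>R e)) has_field_derivative F x e) (at 0)"
      by (simp add: has_field_derivative_def)
    then have *: "((\<lambda>h. (f (x + h *\<^sub>R e) - f x) / h) \<longlongrightarrow> F x e) (at 0)"
      by (simp add: DERIV_def)
    have "filterlim (\<lambda>n. inverse (real (Suc n))) (at 0) sequentially"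
      unfolding filterlim_at using LIMSEQ_inverse_real_of_nat by auto
    from filterlim_compose[OF * this] show ?thesis
      by (simp add: q_def divide_inverse mult.commute)
  qed
  have qbound: "norm (q n x) \<le> B * indicator C x" for n x
  proof (cases "x \<in> C")
    case True
    let ?h = "inverse (real (Suc n))"
    \<comment> \<open>The mean value theorem along the segment turns the quotient into the
      directional derivative at an intermediate point. That point may lie outside K, so the global
      bound \<open>B'\<close> is used.\<close>
    have "((\<lambda>s. f (x + s *\<^sub>R e)) has_derivative (\<lambda>s. F (x + r *\<^sub>R e) (s *\<^sub>R e))) (at r within {0..?h})" for r
      by (rule derivative_eq_intros has_derivative_compose[where g = f, OF _ deriv, THEN has_derivative_eq_rhs]
          | simp add: deriv)+
    then have "\<exists>r\<in>{0<..<?h}. f (x + ?h *\<^sub>R e) - f (x + 0 *\<^sub>R e) = F (x + r *\<^sub>R e) ((?h - 0) *\<^sub>R e)"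
      by (intro mvt_simple) auto
    then obtain r where "f (x + ?h *\<^sub>R e) - f x = F (x + r *\<^sub>R e) (?h *\<^sub>R e)"
      by auto
    also have "\<dots> = ?h * F (x + r *\<^sub>R e) e"
      by (simp add: linear_cmul[OF has_derivative_linear[OF deriv]] del: of_nat_Suc)
    finally have "q n x = F (x + r *\<^sub>R e) e"
      unfolding q_def by (simp add: field_simps)
    then show ?thesis using B' True by simp
  next
    case False
    then have far: "norm x > R + norm e" by (simp add: C_def)
    have "norm (inverse (real (Suc n)) *\<^sub>R e) \<le> norm e"
      by (simp add: mult_left_le_one_le inverse_le_1_iff)
    then have "norm (x + inverse (real (Suc n)) *\<^sub>R e) > R"
      using far norm_diff_ineq[of x "inverse (real (Suc n)) *\<^sub>R e"] by linarith
    moreover have "norm x > R"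
      using far norm_ge_zero[of e] by linarith
    ultimately have "f (x + inverse (real (Suc n)) *\<^sub>R e) = 0" "f x = 0"
      using R supp by (meson not_le)+
    then show ?thesis using False by (simp add: q_def)
  qed
  have "(\<lambda>n. LINT x|lborel. q n x) \<longlonglongrightarrow> (LINT x|lborel. F x e)"
  proof (rule integral_dominated_convergence)
    show "(\<lambda>x. F x e) \<in> borel_measurable lborel"
      using borel_measurable_continuous_onI[OF cont] by simp
    show "q n \<in> borel_measurable lborel" for n
    proof -
      have "continuous_on UNIV (q n)"
        unfolding q_def
        by (intro continuous_intros continuous_on_compose2[OF contf]) auto
      then show ?thesis using borel_measurable_continuous_onI by simp
    qed
    have "C \<in> sets lborel" "emeasure lborel C < \<infinity>"
      unfolding C_def by (simp_all only: emeasure_lborel_cball_finite) simp_all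
    then show "integrable lborel (\<lambda>x. B * indicator C x)"
      by (intro integrable_mult_right) simp
  qed (use qlim qbound in auto)
  then show ?thesis using q0 LIMSEQ_unique by (simp add: LIMSEQ_const_iff)
qed

text \<open>Integrate the derivative of \<open>(x \<bullet> e) * (f x)\<^sup>2\<close> and absorb half of the square of \<open>f\<close>.\<close>

lemma poincare_directional:
  fixes f :: "'a::euclidean_space \<Rightarrow> real"
  assumes deriv: "\<And>x. (f has_derivative F x) (at x)"
    and cont: "continuous_on UNIV (\<lambda>x. F x e)" and e: "norm e = 1"
    and K: "compact K" and supp: "\<And>x. x \<notin> K \<Longrightarrow> f x = 0"
    and R: "\<And>x. x \<in> K \<Longrightarrow> norm x \<le> R"
  shows "(LINT x|lborel. (f x)\<^sup>2) \<le> 4 * R\<^sup>2 * (LINT x|lborel. (F x e)\<^sup>2)"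
proof -
  define g where "g = (\<lambda>x. (x \<bullet> e) * (f x)\<^sup>2)"
  define G where "G = (\<lambda>x h. (h \<bullet> e) * (f x)\<^sup>2 + (x \<bullet> e) * (2 * f x * F x h))"
  have contf: "continuous_on UNIV f"
    using deriv has_derivative_continuous by (force simp: continuous_on_eq_continuous_at)
  have suppF: "F x e = 0" if "x \<notin> K" for x
    using derivative_eq_0_off_support[OF deriv K supp that] by simp
  have "(g has_derivative G x) (at x)" for x
    unfolding g_def G_def
    by (auto intro!: derivative_eq_intros deriv simp: algebra_simps)
  moreover have "continuous_on UNIV (\<lambda>x. G x e)"
    unfolding G_def by (intro continuous_intros contf cont)
  ultimately have "(LINT x|lborel. G x e) = 0"
    by (rule integral_directional_derivative_eq_0[OF _ _ K]) (auto simp: g_def supp)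
  moreover have int1: "integrable lborel (\<lambda>x. (f x)\<^sup>2)"
    by (rule integrable_lborel_compact_support[OF _ K]) (auto intro!: continuous_intros contf simp: supp)
  moreover have int2: "integrable lborel (\<lambda>x. (F x e)\<^sup>2)"
    by (rule integrable_lborel_compact_support[OF _ K]) (auto intro!: continuous_intros cont simp: suppF)
  moreover have int3: "integrable lborel (\<lambda>x. (x \<bullet> e) * (2 * f x * F x e))"
    by (rule integrable_lborel_compact_support[OF _ K])
      (auto intro!: continuous_intros contf cont simp: suppF)
  moreover have "e \<bullet> e = 1" using e by (simp add: norm_eq_1)
  ultimately have eq: "(LINT x|lborel. (f x)\<^sup>2) = (LINT x|lborel. - ((x \<bullet> e) * (2 * f x * F x e)))"
    unfolding G_def by simp
  \<comment> \<open>Young's inequality weighted to leave exactly half of the integral of the square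
    of f on the right; it is twice the square
    \<open>(f x / 2 + (x \<bullet> e) * F x e)\<^sup>2\<close> expanded. Absorbing that half doubles
    2 R^2 to the constant 4 R^2.\<close>
  also have "\<dots> \<le> (LINT x|lborel. (1/2) * (f x)\<^sup>2 + 2 * R\<^sup>2 * (F x e)\<^sup>2)"
  proof (rule integral_mono)
    fix x
    show "- ((x \<bullet> e) * (2 * f x * F x e)) \<le> (1/2) * (f x)\<^sup>2 + 2 * R\<^sup>2 * (F x e)\<^sup>2"
    proof (cases "x \<in> K")
      case True
      have "\<bar>x \<bullet> e\<bar> \<le> R"
        using Cauchy_Schwarz_ineq2[of x e] e R[OF True] by simp
      then have "(x \<bullet> e)\<^sup>2 \<le> R\<^sup>2" by (metis abs_ge_zero power2_abs power_mono)
      then have "(x \<bullet> e)\<^sup>2 * (F x e)\<^sup>2 \<le> R\<^sup>2 * (F x e)\<^sup>2" by (simp add: mult_right_mono)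
      moreover have "0 \<le> (f x / 2 + (x \<bullet> e) * F x e)\<^sup>2" by simp
      then have "- ((x \<bullet> e) * (2 * f x * F x e)) \<le> (1/2) * (f x)\<^sup>2 + 2 * ((x \<bullet> e)\<^sup>2 * (F x e)\<^sup>2)"
        by (simp add: power2_eq_square algebra_simps)
      ultimately show ?thesis by simp
    qed (simp add: suppF)
  qed (use int1 int2 int3 in auto)
  also have "\<dots> = (1/2) * (LINT x|lborel. (f x)\<^sup>2) + 2 * R\<^sup>2 * (LINT x|lborel. (F x e)\<^sup>2)"
    using int1 int2 by simp
  finally show ?thesis by simp
qed

section \<open>Test functions and square-integrable fields on the domain\<close>

text \<open>Bridge between the integrals over the domain in the Sobolev definitions and the
  whole-space calculus: extension by zero changes nothing, and completing the measure preserves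
  integrals of Borel functions.\<close>

lemma lebesgue_on_compact_support:
  fixes f :: "real^'d \<Rightarrow> real"
  assumes "\<Omega> \<in> sets lebesgue" "continuous_on UNIV f" "compact K" "K \<subseteq> \<Omega>" "\<And>x. x \<notin> K \<Longrightarrow> f x = 0"
  shows "integrable (lebesgue_on \<Omega>) f" "(LINT x|lebesgue_on \<Omega>. f x) = (LINT x|lborel. f x)"
proof -
  have meas: "f \<in> borel_measurable lborel"
    using borel_measurable_continuous_onI[OF assms(2)] by simp
  have *: "(\<lambda>x. indicator \<Omega> x *\<^sub>R f x) = f"
    using assms(4,5) by (force simp: indicator_def)
  have "integrable lebesgue f"
    using integrable_lborel_compact_support[OF assms(2,3,5)] integrable_completion[OF meas] by simp
  then show "integrable (lebesgue_on \<Omega>) f"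
    using assms(1) * by (subst integrable_restrict_space) simp_all
  show "(LINT x|lebesgue_on \<Omega>. f x) = (LINT x|lborel. f x)"
    using assms(1) * integral_completion[OF meas] by (subst integral_restrict_space) simp_all
qed

lemma L2_compact_support:
  fixes f :: "real^'d \<Rightarrow> 'b::euclidean_space"
  assumes "\<Omega> \<in> sets lebesgue" "continuous_on UNIV f" "compact K" "K \<subseteq> \<Omega>" "\<And>x. x \<notin> K \<Longrightarrow> f x = 0"
  shows "f \<in> L2 \<Omega>"
proof -
  have "f \<in> borel_measurable borel"
    by (rule borel_measurable_continuous_onI[OF assms(2)])
  then have "f \<in> borel_measurable lborel"
    by simp
  then have "f \<in> borel_measurable lebesgue"
    by (rule measurable_completion)
  then have "f \<in> borel_measurable (lebesgue_on \<Omega>)"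
    by (rule measurable_restrict_space1)
  moreover have "integrable (lebesgue_on \<Omega>) (\<lambda>x. (norm (f x))\<^sup>2)"
    using assms by (intro lebesgue_on_compact_support(1)[of _ _ K]) (auto intro!: continuous_intros)
  ultimately show ?thesis by (simp add: L2_def)
qed

text \<open>Dominated by means of (a + b)^2 \<le> 2 a^2 + 2 b^2. It makes the two integrals in
  \<open>H1_0\<close> genuine, so that they can be compared by monotonicity.\<close>

lemma L2_norm_diff_integrable:
  assumes "f \<in> L2 \<Omega>" "g \<in> L2 \<Omega>"
  shows "integrable (lebesgue_on \<Omega>) (\<lambda>x. (norm (f x - g x))\<^sup>2)"
proof (rule Bochner_Integration.integrable_bound)
  show "integrable (lebesgue_on \<Omega>) (\<lambda>x. 2 * (norm (f x))\<^sup>2 + 2 * (norm (g x))\<^sup>2)"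
    using assms by (auto simp: L2_def)
  have [measurable]: "f \<in> borel_measurable (lebesgue_on \<Omega>)" "g \<in> borel_measurable (lebesgue_on \<Omega>)"
    using assms by (auto simp: L2_def)
  show "(\<lambda>x. (norm (f x - g x))\<^sup>2) \<in> borel_measurable (lebesgue_on \<Omega>)" by measurable
  have "(norm (f x - g x))\<^sup>2 \<le> 2 * (norm (f x))\<^sup>2 + 2 * (norm (g x))\<^sup>2" for x
  proof -
    have "(norm (f x - g x))\<^sup>2 \<le> (norm (f x) + norm (g x))\<^sup>2"
      by (intro power_mono norm_triangle_ineq4 norm_ge_zero)
    also have "\<dots> \<le> 2 * (norm (f x))\<^sup>2 + 2 * (norm (g x))\<^sup>2"
      using sum_squares_bound[of "norm (f x)" "norm (g x)"] by (simp add: power2_sum)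
    finally show ?thesis .
  qed
  then show "AE x in lebesgue_on \<Omega>. norm ((norm (f x - g x))\<^sup>2) \<le> norm (2 * (norm (f x))\<^sup>2 + 2 * (norm (g x))\<^sup>2)"
    by (auto intro!: AE_I2)
qed

lemma test_function_derivative:
  fixes \<phi> :: "real^'d \<Rightarrow> real"
  assumes "test_function \<Omega> \<phi>"
  shows "(\<phi> has_derivative frechet_derivative \<phi> (at x)) (at x)"
    "continuous_on UNIV \<phi>" "continuous_on UNIV (partial_deriv j \<phi>)"
proof -
  have "C_k (Suc 0) \<phi>"
    using assms unfolding test_function_def smooth_def by blast
  then have *: "\<phi> differentiable_on UNIV" "continuous_on UNIV (partial_deriv j \<phi>)" by auto
  then show "(\<phi> has_derivative frechet_derivative \<phi> (at x)) (at x)"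
    by (simp add: differentiable_on_def frechet_derivative_works[symmetric])
  show "continuous_on UNIV \<phi>" "continuous_on UNIV (partial_deriv j \<phi>)"
    using * by (auto intro: differentiable_imp_continuous_on)
qed

lemma test_function_support:
  fixes \<phi> :: "real^'d \<Rightarrow> real"
  assumes "test_function \<Omega> \<phi>"
  obtains K where "compact K" "K \<subseteq> \<Omega>" "\<And>x. x \<notin> K \<Longrightarrow> \<phi> x = 0"
    "\<And>x j. x \<notin> K \<Longrightarrow> partial_deriv j \<phi> x = 0"
proof -
  obtain K where K: "compact K" "K \<subseteq> \<Omega>" "\<And>x. x \<notin> K \<Longrightarrow> \<phi> x = 0"
    using assms unfolding test_function_def by blast
  then show thesis
    using derivative_eq_0_off_support[OF test_function_derivative(1)[OF assms] K(1,3)]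
    by (intro that[of K]) (auto simp: partial_deriv_def)
qed

text \<open>The radius R bounds the domain and hence every support inside it, so the constant is the
  same for all approximating functions; this uniformity is essential when they vary with
  \<epsilon>.\<close>

lemma test_function_poincare:
  fixes \<phi> :: "real^'d \<Rightarrow> real"
  assumes "test_function \<Omega> \<phi>" "\<Omega> \<in> sets lebesgue" "\<And>x. x \<in> \<Omega> \<Longrightarrow> norm x \<le> R"
  shows "(LINT x|lebesgue_on \<Omega>. (\<phi> x)\<^sup>2) \<le> 4 * R\<^sup>2 * (LINT x|lebesgue_on \<Omega>. (partial_deriv j \<phi> x)\<^sup>2)"
proof -
  obtain K where K: "compact K" "K \<subseteq> \<Omega>" "\<And>x. x \<notin> K \<Longrightarrow> \<phi> x = 0"
    "\<And>x. x \<notin> K \<Longrightarrow> partial_deriv j \<phi> x = 0"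
    using test_function_support[OF assms(1)] by metis
  note cont = test_function_derivative(2,3)[OF assms(1)]
  have "(LINT x|lborel. (\<phi> x)\<^sup>2) \<le> 4 * R\<^sup>2 * (LINT x|lborel. (partial_deriv j \<phi> x)\<^sup>2)"
    unfolding partial_deriv_def
    using test_function_derivative[OF assms(1)] K assms(3)
    by (intro poincare_directional[of _ _ _ K]) (auto simp: partial_deriv_def[abs_def] norm_axis_1)
  then show ?thesis
    using assms(2) K cont
    by (simp add: lebesgue_on_compact_support(2)[of _ _ K] continuous_intros)
qed

text \<open>Each component comes with its own support; there are finitely many of them, so their
  union is still compact in the domain.\<close>

lemma test_field_L2:
  fixes \<phi> :: "real^'d \<Rightarrow> real^'d"
  assumes "\<And>i. test_function \<Omega> (\<lambda>x. \<phi> x $ i)" "\<Omega> \<in> sets lebesgue"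
  shows "\<phi> \<in> L2 \<Omega>" "jacobian \<phi> \<in> L2 \<Omega>"
proof -
  have "\<exists>K. compact K \<and> K \<subseteq> \<Omega> \<and> (\<forall>x. x \<notin> K \<longrightarrow> \<phi> x $ i = 0 \<and>
      (\<forall>j. partial_deriv j (\<lambda>y. \<phi> y $ i) x = 0))" for i
    using test_function_support[OF assms(1)[of i]] by metis
  then obtain K where K: "\<And>i. compact (K i)" "\<And>i. K i \<subseteq> \<Omega>" "\<And>i x. x \<notin> K i \<Longrightarrow> \<phi> x $ i = 0"
      "\<And>i x j. x \<notin> K i \<Longrightarrow> partial_deriv j (\<lambda>y. \<phi> y $ i) x = 0"
    by metis
  have cpt: "compact (\<Union>i. K i)" and sub: "(\<Union>i. K i) \<subseteq> \<Omega>"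
    using K by (auto intro!: compact_UN)
  have "continuous_on UNIV (\<lambda>x. \<chi> i. \<phi> x $ i)"
    using test_function_derivative(2)[OF assms(1)] by (intro continuous_on_vec_lambda)
  then show "\<phi> \<in> L2 \<Omega>"
    using K(3) by (intro L2_compact_support[OF assms(2) _ cpt sub]) (auto simp: vec_eq_iff)
  have "continuous_on UNIV (jacobian \<phi>)"
    unfolding jacobian_def[abs_def]
    using test_function_derivative(3)[OF assms(1)] by (intro continuous_on_vec_lambda)
  then show "jacobian \<phi> \<in> L2 \<Omega>"
    using K(4) by (intro L2_compact_support[OF assms(2) _ cpt sub]) (auto simp: vec_eq_iff jacobian_def)
qed

section \<open>Components of \<open>H1_0\<close> fields with vanishing diagonal weak
  derivative\<close>

lemma weak_gradient_in_L2:
  assumes "u \<in> H1 \<Omega>"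
  shows "weak_gradient \<Omega> u \<in> L2 \<Omega>"
proof -
  have "\<exists>G. G \<in> L2 \<Omega> \<and> has_weak_gradient \<Omega> u G"
    using assms by (auto simp: H1_def)
  from someI_ex[OF this] show ?thesis by (simp add: weak_gradient_def)
qed

lemma square_component_le_norm_square:
  fixes v :: "real^'n" and A :: "real^'n^'m"
  shows "(v $ i)\<^sup>2 \<le> (norm v)\<^sup>2" "(A $ j $ i)\<^sup>2 \<le> (norm A)\<^sup>2"
proof -
  have "\<bar>A $ j $ i\<bar> \<le> norm A"
    using component_le_norm_cart[of "A $ j" i] Finite_Cartesian_Product.norm_nth_le[of A j] by linarith
  then show "(A $ j $ i)\<^sup>2 \<le> (norm A)\<^sup>2" by (metis abs_ge_zero power2_abs power_mono)
  show "(v $ i)\<^sup>2 \<le> (norm v)\<^sup>2"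
    by (metis abs_ge_zero power2_abs power_mono component_le_norm_cart)
qed

text \<open>Where the diagonal entry of the weak gradient is 0, the i-th derivative of the i-th
  component of an approximating \<phi> is, up to sign, an entry of the gradient error. It is thus
  small in L2, the Poincare inequality makes that component of \<phi> small, and the corresponding
  component of u is close to it.\<close>

lemma H1_0_component_eq_0:
  fixes u :: "real^'d \<Rightarrow> real^'d"
  assumes u: "u \<in> H1_0 \<Omega>" and \<Omega>: "\<Omega> \<in> sets lebesgue" "bounded \<Omega>"
    and grad: "AE x in lebesgue_on \<Omega>. weak_gradient \<Omega> u x $ i $ i = 0"
  shows "AE x in lebesgue_on \<Omega>. u x $ i = 0"
proof -
  have uH: "u \<in> H1 \<Omega>" and uL: "u \<in> L2 \<Omega>" using u by (auto simp: H1_0_def H1_def)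
  then have meas [measurable]: "u \<in> borel_measurable (lebesgue_on \<Omega>)" by (simp add: L2_def)
  have [measurable]: "(\<lambda>x. u x $ i) \<in> borel_measurable (lebesgue_on \<Omega>)"
    by (rule measurable_compose[OF meas borel_measurable_continuous_onI])
      (rule continuous_on_component[OF continuous_on_id])
  obtain R where R: "\<And>x. x \<in> \<Omega> \<Longrightarrow> norm x \<le> R"
    using \<Omega>(2) unfolding bounded_iff by blast
  let ?I = "\<lambda>f. LINT x|lebesgue_on \<Omega>. f x"
  have ui: "integrable (lebesgue_on \<Omega>) (\<lambda>x. (u x $ i)\<^sup>2)"
    by (rule Bochner_Integration.integrable_bound[where f = "\<lambda>x. (norm (u x))\<^sup>2"])
      (use uL in \<open>auto simp: L2_def square_component_le_norm_square\<close>)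
  \<comment> \<open>The factor collects 2 \<epsilon> from the distance between u and \<phi>, and
    twice the Poincare bound 4 R^2 \<epsilon> for the component of \<phi>.\<close>
  have small: "?I (\<lambda>x. (u x $ i)\<^sup>2) \<le> (2 + 8 * R\<^sup>2) * \<epsilon>" if \<epsilon>: "\<epsilon> > 0" for \<epsilon>
  proof -
    obtain \<phi> where \<phi>: "\<And>i. test_function \<Omega> (\<lambda>x. \<phi> x $ i)"
      and lt: "?I (\<lambda>x. (norm (u x - \<phi> x))\<^sup>2) + ?I (\<lambda>x. (norm (weak_gradient \<Omega> u x - jacobian \<phi> x))\<^sup>2) < \<epsilon>"
      using u \<epsilon> unfolding H1_0_def by blast
    have int: "integrable (lebesgue_on \<Omega>) (\<lambda>x. (norm (u x - \<phi> x))\<^sup>2)"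
      "integrable (lebesgue_on \<Omega>) (\<lambda>x. (norm (weak_gradient \<Omega> u x - jacobian \<phi> x))\<^sup>2)"
      using test_field_L2[OF \<phi> \<Omega>(1)] uL weak_gradient_in_L2[OF uH] by (auto intro: L2_norm_diff_integrable)
    have nonneg: "0 \<le> ?I (\<lambda>x. (norm (u x - \<phi> x))\<^sup>2)"
      "0 \<le> ?I (\<lambda>x. (norm (weak_gradient \<Omega> u x - jacobian \<phi> x))\<^sup>2)" by simp_all
    obtain K where K: "compact K" "K \<subseteq> \<Omega>" "\<And>x. x \<notin> K \<Longrightarrow> \<phi> x $ i = 0"
      "\<And>x. x \<notin> K \<Longrightarrow> partial_deriv i (\<lambda>y. \<phi> y $ i) x = 0"
      using test_function_support[OF \<phi>[of i]] by metis
    have \<phi>i: "integrable (lebesgue_on \<Omega>) (\<lambda>x. (\<phi> x $ i)\<^sup>2)"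
      using K(3) test_function_derivative(2)[OF \<phi>[of i]]
      by (intro lebesgue_on_compact_support(1)[OF \<Omega>(1) _ K(1,2)]) (auto intro!: continuous_intros)
    have d\<phi>i: "integrable (lebesgue_on \<Omega>) (\<lambda>x. (partial_deriv i (\<lambda>y. \<phi> y $ i) x)\<^sup>2)"
      using K(4) test_function_derivative(3)[OF \<phi>[of i]]
      by (intro lebesgue_on_compact_support(1)[OF \<Omega>(1) _ K(1,2)]) (auto intro!: continuous_intros)
    have "?I (\<lambda>x. (partial_deriv i (\<lambda>y. \<phi> y $ i) x)\<^sup>2)
        \<le> ?I (\<lambda>x. (norm (weak_gradient \<Omega> u x - jacobian \<phi> x))\<^sup>2)"
    proof (rule integral_mono_AE[OF d\<phi>i int(2)])
      show "AE x in lebesgue_on \<Omega>. (partial_deriv i (\<lambda>y. \<phi> y $ i) x)\<^sup>2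
          \<le> (norm (weak_gradient \<Omega> u x - jacobian \<phi> x))\<^sup>2"
        using grad
      proof eventually_elim
        case (elim x)
        then show ?case
          using square_component_le_norm_square(2)[of "weak_gradient \<Omega> u x - jacobian \<phi> x" i i]
          by (simp add: jacobian_def)
      qed
    qed
    then have "?I (\<lambda>x. (partial_deriv i (\<lambda>y. \<phi> y $ i) x)\<^sup>2) \<le> \<epsilon>"
      using lt nonneg by linarith
    then have "?I (\<lambda>x. (\<phi> x $ i)\<^sup>2) \<le> 4 * R\<^sup>2 * \<epsilon>"
      using test_function_poincare[OF \<phi> \<Omega>(1) R, of i i] mult_left_mono[of _ \<epsilon> "4 * R\<^sup>2"]
      by (smt (verit) zero_le_power2)
    moreover have "?I (\<lambda>x. (u x $ i)\<^sup>2) \<le> ?I (\<lambda>x. 2 * (norm (u x - \<phi> x))\<^sup>2 + 2 * (\<phi> x $ i)\<^sup>2)"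
    proof (rule integral_mono[OF ui])
      fix x
      \<comment> \<open>The right side minus the left side is the square of
        \<open>u x $ i - 2 * \<phi> x $ i\<close>.\<close>
      have "(u x $ i)\<^sup>2 \<le> 2 * ((u x - \<phi> x) $ i)\<^sup>2 + 2 * (\<phi> x $ i)\<^sup>2"
        using zero_le_power2[of "u x $ i - 2 * \<phi> x $ i"]
        by (simp add: power2_eq_square algebra_simps)
      then show "(u x $ i)\<^sup>2 \<le> 2 * (norm (u x - \<phi> x))\<^sup>2 + 2 * (\<phi> x $ i)\<^sup>2"
        using square_component_le_norm_square(1)[of "u x - \<phi> x" i] by linarith
    qed (use int \<phi>i in auto)
    moreover have "\<dots> = 2 * ?I (\<lambda>x. (norm (u x - \<phi> x))\<^sup>2) + 2 * ?I (\<lambda>x. (\<phi> x $ i)\<^sup>2)"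
      using int \<phi>i by simp
    moreover have "(2 + 8 * R\<^sup>2) * \<epsilon> = 2 * \<epsilon> + 2 * (4 * R\<^sup>2 * \<epsilon>)"
      by (simp add: algebra_simps)
    ultimately show ?thesis using lt nonneg by linarith
  qed
  have "?I (\<lambda>x. (u x $ i)\<^sup>2) \<le> 0"
  proof (rule field_le_epsilon)
    fix e :: real assume "e > 0"
    moreover have "2 + 8 * R\<^sup>2 > 0" by (simp add: add_pos_nonneg)
    ultimately show "?I (\<lambda>x. (u x $ i)\<^sup>2) \<le> 0 + e"
      using small[of "e / (2 + 8 * R\<^sup>2)"] by simp
  qed
  then have "?I (\<lambda>x. (u x $ i)\<^sup>2) = 0"
    by (intro antisym) auto
  then have "AE x in lebesgue_on \<Omega>. (u x $ i)\<^sup>2 = 0"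
    using integral_nonneg_eq_0_iff_AE[OF ui] by simp
  then show ?thesis by simp
qed

section \<open>From almost everywhere to everywhere\<close>

text \<open>The zero set is closed, and a closed set containing almost every point of an open set
  contains all of it: the remainder is open and null, hence empty.\<close>

lemma continuous_AE_eq_0_imp_eq_0:
  fixes u :: "real^'d \<Rightarrow> 'b::real_normed_vector"
  assumes "open \<Omega>" "continuous_on (closure \<Omega>) u" "AE x in lebesgue_on \<Omega>. u x = 0"
    and "x \<in> closure \<Omega>"
  shows "u x = 0"
proof -
  define C where "C = {x \<in> closure \<Omega>. u x = 0}"
  have "closed C"
    unfolding C_def using assms(2) by (intro continuous_closed_preimage_constant) auto
  moreover have "AE x \<in> \<Omega> in lebesgue. x \<in> C"
  proof -
    have "\<Omega> \<in> sets lebesgue"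
      using assms(1) by (simp add: borel_open)
    then have "AE x \<in> \<Omega> in lebesgue. u x = 0"
      using assms(3) by (simp add: AE_restrict_space_iff)
    then show ?thesis
      by eventually_elim (auto simp: C_def closure_subset[THEN subsetD])
  qed
  ultimately have "\<Omega> \<subseteq> C"
    using mem_closed_if_AE_lebesgue_open[OF assms(1)] by blast
  then have "closure \<Omega> \<subseteq> C"
    using \<open>closed C\<close> closure_minimal by blast
  then show ?thesis using assms(4) by (auto simp: C_def)
qed

section \<open>Vertex limits in the mass lumped product\<close>

text \<open>Outside the relative interior, q is still in its closure by convexity; inside,
  connectedness of a set that is not a singleton excludes isolated points.\<close>

lemma extreme_point_islimpt_rel_interior:
  fixes S :: "'a::euclidean_space set"
  assumes "convex S" "aff_dim S > 0" "q extreme_point_of S"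
  shows "q islimpt rel_interior S"
proof (cases "q \<in> rel_interior S")
  case True
  have "rel_interior S \<noteq> {x}" for x
  proof
    assume "rel_interior S = {x}"
    then have "closure S = {x}"
      using convex_closure_rel_interior[OF assms(1)] by simp
    then show False
      using assms(2) closure_subset[of S] aff_dim_subset[of S "{x}"] by simp
  qed
  then show ?thesis
    using True assms(1) by (intro connected_imp_perfect) (auto simp: convex_connected convex_rel_interior)
next
  case False
  have "q \<in> closure (rel_interior S)"
    using assms(1,3) closure_subset[of S]
    by (auto simp: convex_closure_rel_interior extreme_point_of_def)
  then show ?thesis using False by (simp add: closure_def)
qed

text \<open>\<open>Lim\<close> determines a value only for a nontrivial filter, so besides v
  vanishing on the surface each vertex must be a limit point of its open simplex. Dimension at least
  two ensures this; in dimension one the simplices would be single points.\<close>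

lemma lumped_inner_eq_0:
  fixes \<S> :: "(real^'d) set set"
  assumes "CARD('d) > 1" "\<And>S. S \<in> \<S> \<Longrightarrow> (int CARD('d) - 1) simplex S" "\<And>x. x \<in> \<Union>\<S> \<Longrightarrow> v x = 0"
  shows "lumped_inner \<S> v w = 0"
proof -
  have "Lim (at q within rel_interior S) (\<lambda>x. v x \<bullet> w x) = 0"
    if S: "S \<in> \<S>" and q: "q extreme_point_of S" for S q
  proof (rule tendsto_Lim)
    have "aff_dim S > 0"
      using assms(1) aff_dim_simplex[OF assms(2)[OF S]] by simp
    then show "at q within rel_interior S \<noteq> bot"
      using extreme_point_islimpt_rel_interior[OF convex_simplex[OF assms(2)[OF S]] _ q]
      by (simp add: trivial_limit_within)
    have "\<forall>\<^sub>F x in at q within rel_interior S. v x \<bullet> w x = 0"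
      unfolding eventually_at_filter
      using assms(3) S rel_interior_subset[of S] by (intro always_eventually) (metis UnionI inner_zero_left subsetD)
    then show "((\<lambda>x. v x \<bullet> w x) \<longlongrightarrow> 0) (at q within rel_interior S)"
      by (rule tendsto_eventually)
  qed
  then show ?thesis by (simp add: lumped_inner_def)
qed

section \<open>Bulk mesh, viscosity and strain\<close>

text \<open>The points missed lie on the frontiers of finitely many convex sets, which are
  null.\<close>

lemma simplicial_partition_AE_interior:
  fixes \<Omega> :: "(real^'d) set"
  assumes "simplicial_partition \<Omega> \<T>"
  shows "AE x in lebesgue. x \<in> \<Omega> \<longrightarrow> (\<exists>K\<in>\<T>. x \<in> interior K)"
proof -
  have fin: "finite \<T>" and simplex: "\<And>K. K \<in> \<T> \<Longrightarrow> int CARD('d) simplex K" and cover: "\<Union>\<T> = closure \<Omega>"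
    using assms by (auto simp: simplicial_partition_def triangulation_def)
  have "negligible (\<Union>K\<in>\<T>. frontier K)"
    using fin simplex by (intro negligible_Union) (auto intro: negligible_convex_frontier convex_simplex)
  then have "AE x in lebesgue. x \<notin> (\<Union>K\<in>\<T>. frontier K)"
    unfolding negligible_iff_null_sets by (rule AE_not_in)
  then show ?thesis
  proof eventually_elim
    case (elim x)
    show ?case
    proof
      assume "x \<in> \<Omega>"
      then obtain K where "K \<in> \<T>" "x \<in> K" using cover closure_subset by blast
      then show "\<exists>K\<in>\<T>. x \<in> interior K"
        using elim closure_subset[of K] by (auto simp: frontier_def)
    qed
  qed
qed

text \<open>\<open>S_0\<close> says nothing about values off the open elements. The part N of the
  domain lying there is null, and by completeness of Lebesgue measure every subset of N is
  measurable, whatever f does on it.\<close>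

lemma S_0_borel_measurable:
  fixes \<Omega> :: "(real^'d) set"
  assumes part: "simplicial_partition \<Omega> \<T>" and f: "f \<in> S_0 \<T>" and \<Omega>: "\<Omega> \<in> sets lebesgue"
  shows "f \<in> borel_measurable (lebesgue_on \<Omega>)"
proof -
  obtain c where c: "\<And>K x. K \<in> \<T> \<Longrightarrow> x \<in> interior K \<Longrightarrow> f x = c K"
    using f unfolding S_0_def constant_on_def by (auto dest!: bchoice)
  have fin: "finite \<T>"
    using part by (auto simp: simplicial_partition_def triangulation_def)
  define N where "N = {x \<in> \<Omega>. \<not> (\<exists>K\<in>\<T>. x \<in> interior K)}"
  have meas: "\<Omega> \<inter> \<Union>(interior ` \<A>) \<in> sets lebesgue" for \<A> :: "(real^'d) set set"
  proof -
    have "open (\<Union>(interior ` \<A>))" by (rule open_UN) simp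
    then show ?thesis using \<Omega> by (intro sets.Int) (simp_all add: borel_open)
  qed
  have "negligible N"
  proof -
    have "N = \<Omega> - (\<Omega> \<inter> \<Union>(interior ` \<T>))" by (auto simp: N_def)
    then have "N \<in> sets lebesgue" using meas \<Omega> by (metis sets.Diff)
    moreover have "AE x in lebesgue. x \<notin> N"
      using simplicial_partition_AE_interior[OF part] by eventually_elim (auto simp: N_def)
    ultimately show ?thesis
      by (simp add: negligible_iff_null_sets AE_iff_null_sets)
  qed
  show ?thesis
  proof (rule measurableI)
    fix A :: "real set"
    have "f -` A \<inter> \<Omega> = (\<Omega> \<inter> \<Union>(interior ` {K \<in> \<T>. c K \<in> A})) \<union> (N \<inter> f -` A)"
      by (auto simp: N_def c)
    moreover have "N \<inter> f -` A \<in> sets lebesgue"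
      using negligible_subset[OF \<open>negligible N\<close>] by (intro negligible_imp_sets) auto
    ultimately have "f -` A \<inter> \<Omega> \<in> sets lebesgue"
      using meas[of "{K \<in> \<T>. c K \<in> A}"] by (simp only: sets.Un)
    then show "f -` A \<inter> space (lebesgue_on \<Omega>) \<in> sets (lebesgue_on \<Omega>)"
      using \<Omega> by (subst sets_restrict_space_iff) (simp_all add: space_restrict_space)
  qed simp
qed

text \<open>An open element that misses the surface is connected, hence lies on one side of it.\<close>

lemma viscosity_values:
  fixes \<Omega> :: "(real^'d) set"
  assumes "simplicial_partition \<Omega> \<T>" "viscosity \<Omega> \<T> \<S> \<mu>\<^sub>m \<mu>\<^sub>p \<mu>" "K \<in> \<T>" "x \<in> interior K"
  shows "\<mu> x \<in> {\<mu>\<^sub>m, \<mu>\<^sub>p, (\<mu>\<^sub>m + \<mu>\<^sub>p) / 2}"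
proof (cases "interior K \<inter> \<Union>\<S> = {}")
  case True
  have "convex K" and sub: "interior K \<subseteq> \<Omega>"
    using assms(1,3) convex_simplex by (auto simp: simplicial_partition_def)
  then have "connected (interior K)"
    by (simp add: convex_connected convex_interior)
  then have "inside (\<Union>\<S>) \<inter> interior K = {} \<or> outside (\<Union>\<S>) \<inter> interior K = {}"
    using inside_outside_intersect_connected[of "interior K" "\<Union>\<S>"] True by blast
  moreover have "interior K \<subseteq> inside (\<Union>\<S>) \<union> outside (\<Union>\<S>)"
    using True by auto
  ultimately have "interior K \<subseteq> inside (\<Union>\<S>) \<or> interior K \<subseteq> \<Omega> \<inter> outside (\<Union>\<S>)"
    using sub by blast
  then show ?thesis
    using assms(2-4) unfolding viscosity_def by blast
next
  case False
  then show ?thesis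
    using assms(2-4) unfolding viscosity_def by blast
qed

text \<open>Symmetrisation is linear, so it preserves measurability, and it does not increase the
  Frobenius norm because transposition is an isometry.\<close>

lemma strain_in_L2:
  fixes \<Omega> :: "(real^'d) set"
  assumes "u \<in> H1 \<Omega>"
  shows "strain \<Omega> u \<in> L2 \<Omega>"
proof -
  let ?G = "weak_gradient \<Omega> u"
  have G: "?G \<in> borel_measurable (lebesgue_on \<Omega>)" "integrable (lebesgue_on \<Omega>) (\<lambda>x. (norm (?G x))\<^sup>2)"
    using weak_gradient_in_L2[OF assms] by (auto simp: L2_def)
  have "linear (\<lambda>A::real^'d^'d. (1/2) *\<^sub>R (A + transpose A))"
    by (rule linearI) (auto simp: transpose_def vec_eq_iff algebra_simps)
  then have "continuous_on UNIV (\<lambda>A::real^'d^'d. (1/2) *\<^sub>R (A + transpose A))"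
    by (simp add: linear_continuous_on linear_linear)
  then have "(\<lambda>A::real^'d^'d. (1/2) *\<^sub>R (A + transpose A)) \<in> borel_measurable borel"
    by (rule borel_measurable_continuous_onI)
  from measurable_compose[OF G(1) this] have meas: "strain \<Omega> u \<in> borel_measurable (lebesgue_on \<Omega>)"
    by (simp add: strain_def[abs_def])
  have norm_transpose: "norm (transpose A) = norm A" for A :: "real^'d^'d"
  proof -
    have "transpose A \<bullet> transpose A = A \<bullet> A"
      unfolding inner_vec_def transpose_def by simp (rule sum.swap)
    then show ?thesis by (simp add: norm_eq_sqrt_inner)
  qed
  have "norm (strain \<Omega> u x) \<le> norm (?G x)" for x
    using norm_triangle_ineq[of "?G x" "transpose (?G x)"] norm_transpose[of "?G x"]
    by (simp add: strain_def)
  then have "AE x in lebesgue_on \<Omega>. norm ((norm (strain \<Omega> u x))\<^sup>2) \<le> norm ((norm (?G x))\<^sup>2)"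
    by (auto intro!: AE_I2 power_mono)
  then have "integrable (lebesgue_on \<Omega>) (\<lambda>x. (norm (strain \<Omega> u x))\<^sup>2)"
    using meas by (intro Bochner_Integration.integrable_bound[OF G(2)]) measurable
  then show ?thesis using meas by (simp add: L2_def)
qed

text \<open>The upper bound on \<mu> gives integrability, without which a zero integral would carry
  no information; positivity of \<mu> then passes the vanishing of the product on to E.\<close>

lemma weighted_L2_inner_eq_0:
  fixes \<Omega> :: "(real^'d) set"
  assumes part: "simplicial_partition \<Omega> \<T>" and visc: "viscosity \<Omega> \<T> \<S> \<mu>\<^sub>m \<mu>\<^sub>p \<mu>"
    and pos: "\<mu>\<^sub>m > 0" "\<mu>\<^sub>p > 0" and \<Omega>: "\<Omega> \<in> sets lebesgue" and E: "E \<in> L2 \<Omega>"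
    and eq: "L2_inner \<Omega> (\<lambda>x. \<mu> x *\<^sub>R E x) E = 0"
  shows "AE x in lebesgue_on \<Omega>. E x = 0"
proof -
  have [measurable]: "\<mu> \<in> borel_measurable (lebesgue_on \<Omega>)" "E \<in> borel_measurable (lebesgue_on \<Omega>)"
    using S_0_borel_measurable[OF part _ \<Omega>] visc E by (auto simp: viscosity_def L2_def)
  have "AE x in lebesgue_on \<Omega>. \<exists>K\<in>\<T>. x \<in> interior K"
    using simplicial_partition_AE_interior[OF part] \<Omega> by (simp add: AE_restrict_space_iff)
  then have bnd: "AE x in lebesgue_on \<Omega>. 0 < \<mu> x \<and> \<mu> x \<le> \<mu>\<^sub>m + \<mu>\<^sub>p"
  proof eventually_elim
    case (elim x)
    then show ?case using viscosity_values[OF part visc] pos by fastforce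
  qed
  have int: "integrable (lebesgue_on \<Omega>) (\<lambda>x. \<mu> x * (norm (E x))\<^sup>2)"
  proof (rule Bochner_Integration.integrable_bound)
    show "integrable (lebesgue_on \<Omega>) (\<lambda>x. (\<mu>\<^sub>m + \<mu>\<^sub>p) * (norm (E x))\<^sup>2)"
      using E by (simp add: L2_def)
    show "AE x in lebesgue_on \<Omega>. norm (\<mu> x * (norm (E x))\<^sup>2) \<le> norm ((\<mu>\<^sub>m + \<mu>\<^sub>p) * (norm (E x))\<^sup>2)"
      using bnd by eventually_elim (auto simp: abs_mult intro!: mult_right_mono)
  qed measurable
  have "(LINT x|lebesgue_on \<Omega>. \<mu> x * (norm (E x))\<^sup>2) = 0"
    using eq by (simp add: L2_inner_def power2_norm_eq_inner)
  moreover have "AE x in lebesgue_on \<Omega>. 0 \<le> \<mu> x * (norm (E x))\<^sup>2"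
    using bnd by eventually_elim simp
  ultimately have "AE x in lebesgue_on \<Omega>. \<mu> x * (norm (E x))\<^sup>2 = 0"
    using integral_nonneg_eq_0_iff_AE[OF int] by simp
  then show ?thesis using bnd by eventually_elim auto
qed

section \<open>The energy identity and its consequences\<close>

theorem lemma4:
  fixes \<Omega> :: "(real^'d) set"
    and t :: "nat \<Rightarrow> real" and T_end :: real and M m :: nat
    and \<T> \<S> :: "(real^'d) set set"
    and \<U> :: "(real^'d \<Rightarrow> real^'d) set" and \<P> :: "(real^'d \<Rightarrow> real) set"
    and \<nu> :: "real^'d \<Rightarrow> real^'d"
    and \<gamma> \<mu>\<^sub>m \<mu>\<^sub>p :: real and \<mu> :: "real^'d \<Rightarrow> real"
    and U X :: "real^'d \<Rightarrow> real^'d" and P \<kappa> :: "real^'d \<Rightarrow> real"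
  assumes "CARD('d) = 2 \<or> CARD('d) = 3"
    and "polyhedral_domain \<Omega>"
    and "t 0 = 0" and "\<forall>k<M. t k < t (Suc k)" and "t M = T_end" and "m < M"
    and "simplicial_partition \<Omega> \<T>"
    and "velocity_space \<Omega> \<T> \<U>" and "pressure_space \<Omega> \<P>"
    and "polyhedral_surface \<S>" and "\<Union>\<S> \<subseteq> closure \<Omega>"
    and "unit_normal \<S> \<nu>"
    and "\<gamma> > 0" and "\<mu>\<^sub>m > 0" and "\<mu>\<^sub>p > 0"
    and "viscosity \<Omega> \<T> \<S> \<mu>\<^sub>m \<mu>\<^sub>p \<mu>"
    and "discrete_solution \<Omega> \<S> \<nu> \<U> \<P> \<gamma> \<mu> (t (Suc m) - t m) (\<lambda>_. 0) U P X \<kappa>"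
    and "\<forall>x\<in>\<Union>\<S>. X x = x"
  shows "\<forall>x\<in>closure \<Omega>. U x = 0"
proof -
  note sol = assms(17)[unfolded discrete_solution_def]
  have \<Omega>: "open \<Omega>" "bounded \<Omega>" using assms(2) by (auto simp: polyhedral_domain_def)
  then have \<Omega>_leb: "\<Omega> \<in> sets lebesgue" by (simp add: borel_open)
  have U: "U \<in> \<U>" and P: "P \<in> mean_zero \<Omega> \<P>" and \<kappa>: "\<kappa> \<in> W_space \<S>" using sol by auto
  then have UH: "U \<in> H1_0 \<Omega>" "U \<in> H1 \<Omega>" and cont: "continuous_on (closure \<Omega>) U"
    using assms(8) by (auto simp: velocity_space_def H1_0_def)
  have "lumped_inner \<S> (\<lambda>x. (1 / (t (Suc m) - t m)) *\<^sub>R (X x - x)) (\<lambda>x. \<kappa> x *\<^sub>R \<nu> x) = 0"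
    using assms(1,10,18) by (intro lumped_inner_eq_0) (auto simp: polyhedral_surface_def)
  then have "surf_inner \<S> U (\<lambda>x. \<kappa> x *\<^sub>R \<nu> x) = 0"
    using sol \<kappa> by fastforce
  \<comment> \<open>Equation (c) has the velocity in the first slot, (a) has it in the
    second.\<close>
  then have "surf_inner \<S> (\<lambda>x. \<kappa> x *\<^sub>R \<nu> x) U = 0"
    by (simp add: surf_inner_def inner_commute)
  moreover have "L2_inner \<Omega> P (divergence \<Omega> U) = 0"
    using sol P by (simp add: L2_inner_def mult.commute)
  moreover have "2 * L2_inner \<Omega> (\<lambda>x. \<mu> x *\<^sub>R strain \<Omega> U x) (strain \<Omega> U) - L2_inner \<Omega> P (divergence \<Omega> U)
      - \<gamma> * surf_inner \<S> (\<lambda>x. \<kappa> x *\<^sub>R \<nu> x) U = L2_inner \<Omega> (\<lambda>_. 0) U"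
    using sol U by blast
  ultimately have "L2_inner \<Omega> (\<lambda>x. \<mu> x *\<^sub>R strain \<Omega> U x) (strain \<Omega> U) = 0"
    by (simp add: L2_inner_def)
  then have strain0: "AE x in lebesgue_on \<Omega>. strain \<Omega> U x = 0"
    by (rule weighted_L2_inner_eq_0[OF assms(7,16,14,15) \<Omega>_leb strain_in_L2[OF UH(2)]])
  have "AE x in lebesgue_on \<Omega>. U x $ i = 0" for i
  proof (rule H1_0_component_eq_0[OF UH(1) \<Omega>_leb \<Omega>(2)])
    show "AE x in lebesgue_on \<Omega>. weak_gradient \<Omega> U x $ i $ i = 0"
      using strain0
    proof eventually_elim
      case (elim x)
      then have "strain \<Omega> U x $ i $ i = 0" by simp
      then show ?case by (simp add: strain_def transpose_def)
    qed
  qed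
  then have "AE x in lebesgue_on \<Omega>. \<forall>i. U x $ i = 0"
    by (simp add: AE_all_countable)
  then have "AE x in lebesgue_on \<Omega>. U x = 0"
    by eventually_elim (simp add: vec_eq_iff)
  then show ?thesis
    using continuous_AE_eq_0_imp_eq_0[OF \<Omega>(1) cont] by blast
qed

end
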